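(* Let $\mu$ be a singular measure on $\mathbb{R}^n$ (i.e. singular with respect to the Lebesgue measure) such that $\mu(P)=0$ for every porous set $P\subset\mathbb{R}^n$. Let $f:\mathbb{R}^n\to\mathbb{R}$ be a Lipschitz function which is non-differentiable at $\mu$-a.e. point of $\mathbb{R}^n$. Then for every $C^1$ function $g:\mathbb{R}^n\to\mathbb{R}$ it holds $$\mu(\{x\in\mathbb{R}^n: f(x)=g(x)\})=0.$$
   Context: All sets and functions are assumed to be Borel measurable (in particular, porous sets are Borel). Measures are defined on the Borel $\sigma$-algebra and are positive, locally finite and inner regular (the measure of a set can be approximated from within by compact subsets). A measure $\mu$ is singular with respect to the Lebesgue measure if there is a Borel set $E$ of Lebesgue measure zero with $\mu(\mathbb{R}^n\setminus E)=0$. $B(y,r)$ denotes the open ball centered at $y$ with radius $r$. A set $E\subset\mathbb{R}^n$ is porous at a point $x$ if there exist a constant $C(x)>0$, a sequence of positive numbers $r_k\to 0$ and a sequence of points $y_k\in B(x,r_k)$ such that, for every $k$, $$B(y_k,C(x)r_k)\subset B(x,r_k)\quad\text{and}\quad E\cap B(y_k,C(x)r_k)=\emptyset.$$ The set $E$ is porous if it is porous at every point $x\in E$. *)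

theory Defs
  imports "HOL-Analysis.Analysis"
begin

definition locally_finite_measure :: "'a::topological_space measure \<Rightarrow> bool" where
  "locally_finite_measure M \<longleftrightarrow>
     (\<forall>x. \<exists>U. open U \<and> x \<in> U \<and> emeasure M U < \<infinity>)"

definition inner_regular_measure :: "'a::topological_space measure \<Rightarrow> bool" where
  "inner_regular_measure M \<longleftrightarrow>
     (\<forall>A\<in>sets M. emeasure M A = (SUP K\<in>{K. compact K \<and> K \<subseteq> A}. emeasure M K))"

text \<open>Positivity is built into the type of measures, whose values are extended nonnegative reals.\<close>

definition locally_finite_regular_borel_measure :: "'a::topological_space measure \<Rightarrow> bool" where
  "locally_finite_regular_borel_measure M \<longleftrightarrow>
     sets M = sets borel \<and> locally_finite_measure M \<and> inner_regular_measure M"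

definition lebesgue_singular :: "'a::euclidean_space measure \<Rightarrow> bool" where
  "lebesgue_singular M \<longleftrightarrow>
     (\<exists>E\<in>sets borel. emeasure lborel E = 0 \<and> emeasure M (UNIV - E) = 0)"

definition porous_at :: "'a::metric_space set \<Rightarrow> 'a \<Rightarrow> bool" where
  "porous_at E x \<longleftrightarrow>
     (\<exists>C>0. \<exists>(r :: nat \<Rightarrow> real) (y :: nat \<Rightarrow> 'a).
        (\<forall>k. 0 < r k) \<and> r \<longlonglongrightarrow> 0 \<and>
        (\<forall>k. y k \<in> ball x (r k) \<and>
             ball (y k) (C * r k) \<subseteq> ball x (r k) \<and>
             E \<inter> ball (y k) (C * r k) = {}))"

text \<open>Borel measurability is kept as a separate hypothesis wherever porous sets are measured.\<close>

definition porous :: "'a::metric_space set \<Rightarrow> bool" where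
  "porous E \<longleftrightarrow> (\<forall>x\<in>E. porous_at E x)"

text \<open>The library's \<open>C1_differentiable_on\<close> only covers functions of one real variable;
  here the derivative is continuous in the operator norm.\<close>

definition C1_function :: "('a::real_normed_vector \<Rightarrow> 'b::real_normed_vector) \<Rightarrow> bool" where
  "C1_function g \<longleftrightarrow>
     (\<exists>g' :: 'a \<Rightarrow> ('a \<Rightarrow>\<^sub>L 'b).
        (\<forall>x. (g has_derivative blinfun_apply (g' x)) (at x)) \<and> continuous_on UNIV g')"

end

theory Submission
  imports Defs
begin

text \<open>
  Let \<open>E = {x. f x = g x}\<close>, and split \<open>E\<close> according to whether \<open>E\<close> is porous at the point in
  question. The points of \<open>E\<close> at which \<open>E\<close> is porous form a porous set, because passing to a
  subset only enlarges the holes; so \<open>M\<close> does not charge them, once they are known to be a Borel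
  set (\<open>borel_porosity_points\<close>). At any other point \<open>x\<close> of \<open>E\<close> there are no large holes:
  every \<open>y\<close> close to \<open>x\<close> has a point \<open>z\<close> of \<open>E\<close> at distance \<open>o(\<bar>y - x\<bar>)\<close>. Replacing \<open>f y\<close> by
  \<open>f z = g z\<close> costs \<open>o(\<bar>y - x\<bar>)\<close> by the Lipschitz condition, so the linear expansion of \<open>g\<close> at
  \<open>x\<close> is one for \<open>f\<close> as well (\<open>has_derivative_of_eq_on_nonporous\<close>). Thus \<open>f\<close> is differentiable
  at all these points, and by hypothesis they are \<open>M\<close>-null too.
\<close>

text \<open>
  The hole may stick out of the ball around \<open>x\<close>: doubling the radius and halving the constant
  brings it back inside. In this form the condition on \<open>x\<close>, for a given hole, is the open one
  \<open>dist x y < r\<close>.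
\<close>

lemma porous_at_iff_holes:
  "porous_at E x \<longleftrightarrow>
     (\<exists>c>0. \<forall>\<delta>>0. \<exists>r y. 0 < r \<and> r < \<delta> \<and> dist x y < r \<and> E \<inter> ball y (c * r) = {})"
  (is "_ \<longleftrightarrow> ?R")
proof
  assume "porous_at E x"
  then obtain C r y where C: "C > 0" "\<And>k::nat. 0 < r k" "r \<longlonglongrightarrow> 0"
    "\<And>k. y k \<in> ball x (r k)" "\<And>k. E \<inter> ball (y k) (C * r k) = {}"
    unfolding porous_at_def by blast
  have "\<exists>s w. 0 < s \<and> s < \<delta> \<and> dist x w < s \<and> E \<inter> ball w (C * s) = {}" if "\<delta> > 0" for \<delta>
  proof -
    have "\<forall>\<^sub>F k in sequentially. r k < \<delta>"
      using order_tendstoD(2)[OF C(3) that] .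
    then obtain k where "r k < \<delta>"
      by (meson eventually_happens trivial_limit_sequentially)
    then show ?thesis
      using C(2)[of k] C(4)[of k] C(5)[of k] by (auto simp: mem_ball)
  qed
  with C(1) show ?R by blast
next
  assume ?R
  then obtain c where c: "c > 0"
    "\<And>\<delta>. \<delta> > 0 \<Longrightarrow> \<exists>r y. 0 < r \<and> r < \<delta> \<and> dist x y < r \<and> E \<inter> ball y (c * r) = {}"
    by blast
  have "\<exists>r y. 0 < r \<and> r < inverse (real (Suc k)) \<and> dist x y < r \<and> E \<inter> ball y (c * r) = {}"
    for k by (rule c(2)) simp
  then obtain r y where ry: "\<And>k. 0 < r k" "\<And>k. r k < inverse (real (Suc k))"
    "\<And>k. dist x (y k) < r k" "\<And>k. E \<inter> ball (y k) (c * r k) = {}"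
    by metis
  \<comment> \<open>A hole of radius at most \<open>r k\<close> centred in \<open>ball x (r k)\<close> lies in \<open>ball x (2 * r k)\<close>.\<close>
  define C where "C = min c 1 / 2"
  have r0: "r \<longlonglongrightarrow> 0"
    using tendsto_sandwich[OF _ _ tendsto_const LIMSEQ_inverse_real_of_nat, of r]
      ry(1,2) by (simp add: less_imp_le)
  have small: "C * (2 * r k) \<le> c * r k" "C * (2 * r k) \<le> r k" for k
    using ry(1)[of k] by (auto simp: C_def min_def)
  have "ball (y k) (C * (2 * r k)) \<subseteq> ball x (2 * r k)" for k
  proof
    fix z assume "z \<in> ball (y k) (C * (2 * r k))"
    then have "dist (y k) z < r k" using small(2)[of k] by (simp add: mem_ball)
    then show "z \<in> ball x (2 * r k)"
      using ry(3)[of k] dist_triangle[of x z "y k"] by (simp add: mem_ball)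
  qed
  moreover have "E \<inter> ball (y k) (C * (2 * r k)) = {}" for k
    using ry(4)[of k] subset_ball[OF small(1)[of k], of "y k"] by blast
  moreover have "y k \<in> ball x (2 * r k)" "0 < 2 * r k" for k
    using ry(1,3)[of k] by (auto simp: mem_ball)
  moreover have "(\<lambda>k. 2 * r k) \<longlonglongrightarrow> 0"
    using tendsto_mult_right_zero[OF r0] .
  moreover have "C > 0" using c(1) by (simp add: C_def)
  ultimately show "porous_at E x"
    unfolding porous_at_def by (intro exI[of _ C] conjI exI[of _ "\<lambda>k. 2 * r k"] exI[of _ y]) auto
qed

lemma porous_at_subset:
  assumes "porous_at E x" "P \<subseteq> E"
  shows "porous_at P x"
proof -
  have "P \<inter> A = {}" if "E \<inter> A = {}" for A using that assms(2) by blast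
  with assms(1) show ?thesis unfolding porous_at_def by metis
qed

lemma porous_porosity_points: "porous {x\<in>E. porous_at E x}"
  unfolding porous_def by (auto intro: porous_at_subset)

text \<open>
  Restricting the constant and the bound on the radii to reciprocals of positive integers
  exhibits the points of porosity as a countable union of \<open>G\<^sub>\<delta>\<close> sets.
\<close>

lemma borel_porosity_points:
  fixes E :: "'a::metric_space set"
  assumes "E \<in> sets borel"
  shows "{x\<in>E. porous_at E x} \<in> sets borel"
proof -
  define U where "U n k = (\<Union>(r, y) \<in> {(r, y). 0 < r \<and> r < inverse (real (Suc k)) \<and>
    E \<inter> ball y (inverse (real (Suc n)) * r) = {}}. ball y r)" for n k
  have U: "x \<in> U n k \<longleftrightarrow> (\<exists>r y. 0 < r \<and> r < inverse (real (Suc k)) \<and> dist x y < r \<and>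
      E \<inter> ball y (inverse (real (Suc n)) * r) = {})" for x n k
    unfolding U_def by (auto simp: mem_ball dist_commute)
  have "porous_at E x \<longleftrightarrow> x \<in> (\<Union>n. \<Inter>k. U n k)" for x
  proof
    assume "porous_at E x"
    then obtain c where c: "c > 0"
      "\<And>\<delta>. \<delta> > 0 \<Longrightarrow> \<exists>r y. 0 < r \<and> r < \<delta> \<and> dist x y < r \<and> E \<inter> ball y (c * r) = {}"
      unfolding porous_at_iff_holes by blast
    obtain n where n: "inverse (real (Suc n)) < c"
      using reals_Archimedean[OF c(1)] by blast
    have "x \<in> U n k" for k
    proof -
      obtain r y where ry: "0 < r" "r < inverse (real (Suc k))" "dist x y < r"
        "E \<inter> ball y (c * r) = {}"
        using c(2)[of "inverse (real (Suc k))"] by auto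
      have "inverse (real (Suc n)) * r \<le> c * r"
        using n ry(1) by (intro mult_right_mono) auto
      then have "E \<inter> ball y (inverse (real (Suc n)) * r) = {}"
        using ry(4) subset_ball by blast
      with ry show ?thesis unfolding U by blast
    qed
    then show "x \<in> (\<Union>n. \<Inter>k. U n k)" by blast
  next
    assume "x \<in> (\<Union>n. \<Inter>k. U n k)"
    then obtain n where n: "\<And>k. x \<in> U n k" by blast
    have "\<exists>r y. 0 < r \<and> r < \<delta> \<and> dist x y < r \<and> E \<inter> ball y (inverse (real (Suc n)) * r) = {}"
      if "\<delta> > 0" for \<delta>
    proof -
      obtain k where "inverse (real (Suc k)) < \<delta>"
        using reals_Archimedean[OF \<open>\<delta> > 0\<close>] by blast
      with n[of k] show ?thesis unfolding U by (meson less_trans)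
    qed
    moreover have "inverse (real (Suc n)) > 0" by simp
    ultimately show "porous_at E x" unfolding porous_at_iff_holes by blast
  qed
  then have "{x\<in>E. porous_at E x} = E \<inter> (\<Union>n. \<Inter>k. U n k)" by blast
  moreover have "U n k \<in> sets borel" for n k
    unfolding U_def by (intro borel_open open_UN) auto
  ultimately show ?thesis
    using assms by (simp add: sets.Int sets.countable_UN sets.countable_INT)
qed

lemma dense_near_nonporous_point:
  assumes "\<not> porous_at E x" "c > 0"
  obtains \<delta> where "\<delta> > 0"
    "\<And>y. y \<noteq> x \<Longrightarrow> dist y x < \<delta> \<Longrightarrow> \<exists>z\<in>E. dist z y < c * dist y x"
proof -
  obtain \<delta> where \<delta>: "\<delta> > 0"
    "\<And>r y. 0 < r \<Longrightarrow> r < \<delta> \<Longrightarrow> dist x y < r \<Longrightarrow> E \<inter> ball y (c / 2 * r) \<noteq> {}"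
    using assms unfolding porous_at_iff_holes by (meson half_gt_zero)
  show ?thesis
  proof (rule that[of "\<delta> / 2"])
    fix y assume y: "y \<noteq> x" "dist y x < \<delta> / 2"
    then have "0 < dist y x" by simp
    \<comment> \<open>The radius must exceed \<open>dist y x\<close>; its double compensates the constant \<open>c / 2\<close>.\<close>
    with y have "E \<inter> ball y (c / 2 * (2 * dist y x)) \<noteq> {}"
      by (intro \<delta>(2)) (auto simp: dist_commute)
    then show "\<exists>z\<in>E. dist z y < c * dist y x"
      by (auto simp: mem_ball dist_commute)
  qed (use \<delta> in simp)
qed

text \<open>
  With \<open>z\<close> a point of the coincidence set close to \<open>y\<close>,
  \<open>f y - f x - D (y - x) = (f y - f z) + (g z - g x - D (z - x)) - D (y - z)\<close>.
  The outer terms are at most \<open>L\<close> and \<open>B\<close> (a bound for \<open>D\<close>) times \<open>norm (y - z)\<close>; the middle one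
  is small since \<open>norm (z - x) \<le> 2 * norm (y - x)\<close>.
\<close>

lemma has_derivative_of_eq_on_nonporous:
  fixes f g :: "'a::real_normed_vector \<Rightarrow> 'b::real_normed_vector"
  assumes lip: "L-lipschitz_on UNIV f"
    and D: "(g has_derivative D) (at x)"
    and eq: "f x = g x"
    and nonporous: "\<not> porous_at {x. f x = g x} x"
  shows "(f has_derivative D) (at x)"
proof -
  have lin: "bounded_linear D" using D by (rule has_derivative_bounded_linear)
  then obtain B where B: "B > 0" "\<And>v. norm (D v) \<le> norm v * B"
    using bounded_linear.pos_bounded by blast
  have L: "L \<ge> 0" using lip by (rule lipschitz_on_nonneg)
  have "\<exists>d>0. \<forall>y. norm (y - x) < d \<longrightarrow>
      norm (f y - f x - D (y - x)) \<le> e * norm (y - x)" if e: "e > 0" for e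
  proof -
    \<comment> \<open>Half of \<open>e\<close> goes to the outer terms, half to the expansion of \<open>g\<close> at \<open>z\<close>.\<close>
    define c where "c = min 1 (e / (2 * (L + B)))"
    have LB: "L + B > 0" using L B(1) by simp
    have c: "c > 0" "c \<le> 1" "(L + B) * c \<le> e / 2"
    proof -
      show "c > 0" "c \<le> 1" using e LB by (auto simp: c_def)
      have "c \<le> e / (2 * (L + B))" by (simp add: c_def)
      then have "c * (2 * (L + B)) \<le> e" using LB by (subst (asm) pos_le_divide_eq) auto
      then show "(L + B) * c \<le> e / 2" by (simp add: algebra_simps)
    qed
    obtain d1 where d1: "d1 > 0"
      "\<And>z. norm (z - x) < d1 \<Longrightarrow> norm (g z - g x - D (z - x)) \<le> e / 4 * norm (z - x)"
      using D e unfolding has_derivative_at_alt by (metis zero_less_divide_iff zero_less_numeral)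
    obtain d2 where d2: "d2 > 0"
      "\<And>y. y \<noteq> x \<Longrightarrow> dist y x < d2 \<Longrightarrow> \<exists>z\<in>{x. f x = g x}. dist z y < c * dist y x"
      using dense_near_nonporous_point[OF nonporous c(1)] by blast
    have "norm (f y - f x - D (y - x)) \<le> e * norm (y - x)" if y: "norm (y - x) < min (d1 / 2) d2" for y
    proof (cases "y = x")
      case True
      then show ?thesis using linear_simps(3)[OF lin] by simp
    next
      case False
      then obtain z where z: "f z = g z" "norm (z - y) < c * norm (y - x)"
        using d2(2)[of y] y by (auto simp: dist_norm)
      have zy: "norm (y - z) \<le> c * norm (y - x)" using z(2) by (simp add: norm_minus_commute)
      also have "\<dots> \<le> norm (y - x)" using c(2) by (simp add: mult_left_le_one_le c(1) less_imp_le)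
      finally have zx: "norm (z - x) \<le> 2 * norm (y - x)"
        using norm_triangle_ineq4[of "y - x" "y - z"] by simp
      have mid: "norm (g z - g x - D (z - x)) \<le> e / 2 * norm (y - x)"
        using order_trans[OF d1(2)[of z] mult_left_mono[OF zx, of "e / 4"]] y zx e by simp
      have "norm (f y - f z) \<le> L * norm (y - z)"
        using lipschitz_onD[OF lip, of y z] by (simp add: dist_norm)
      moreover have "norm (D (y - z)) \<le> B * norm (y - z)"
        using B(2)[of "y - z"] by (simp add: mult.commute)
      ultimately have "norm (f y - f z) + norm (D (y - z)) \<le> (L + B) * norm (y - z)"
        by (simp add: distrib_right)
      also have "\<dots> \<le> (L + B) * (c * norm (y - x))"
        using zy LB by (intro mult_left_mono) auto
      also have "\<dots> \<le> e / 2 * norm (y - x)"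
        using mult_right_mono[OF c(3), of "norm (y - x)"] by (simp add: mult.assoc)
      finally have outer: "norm (f y - f z) + norm (D (y - z)) \<le> e / 2 * norm (y - x)" .
      have split: "f y - f x - D (y - x) = (f y - f z) + (g z - g x - D (z - x)) - D (y - z)"
        using z(1) eq by (simp add: linear_simps(2)[OF lin])
      have "norm (f y - f x - D (y - x))
          \<le> norm (f y - f z) + norm (g z - g x - D (z - x)) + norm (D (y - z))"
        unfolding split
        by (rule order_trans[OF norm_triangle_ineq4 add_right_mono[OF norm_triangle_ineq]])
      also have "\<dots> \<le> e * norm (y - x)" using mid outer by simp
      finally show ?thesis .
    qed
    then show ?thesis using d1(1) d2(1) by (intro exI[of _ "min (d1 / 2) d2"]) auto
  qed
  with lin show ?thesis unfolding has_derivative_at_alt by blast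
qed

theorem theorem1p1:
  fixes M :: "(real ^ 'n) measure"
    and f g :: "real ^ 'n \<Rightarrow> real"
  assumes "locally_finite_regular_borel_measure M"
    and "lebesgue_singular M"
    and "\<And>P. P \<in> sets borel \<Longrightarrow> porous P \<Longrightarrow> emeasure M P = 0"
    and "\<exists>L. L-lipschitz_on UNIV f"
    and "AE x in M. \<not> f differentiable (at x)"
    and "C1_function g"
  shows "emeasure M {x. f x = g x} = 0"
proof -
  define E where "E = {x. f x = g x}"
  have M: "sets M = sets borel"
    using assms(1) by (simp add: locally_finite_regular_borel_measure_def)
  obtain L where L: "L-lipschitz_on UNIV f" using assms(4) by blast
  obtain g' where g': "\<And>x. (g has_derivative blinfun_apply (g' x)) (at x)"
    using assms(6) unfolding C1_function_def by blast
  have "continuous_on UNIV f" using L by (rule lipschitz_on_continuous_on)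
  moreover have "continuous_on UNIV g"
    using g' has_derivative_continuous by (blast intro: continuous_at_imp_continuous_on)
  ultimately have "closed E" unfolding E_def by (rule closed_Collect_eq)
  then have E: "E \<in> sets borel" by (rule borel_closed)
  have "{x\<in>E. porous_at E x} \<in> null_sets M"
    using assms(3)[OF borel_porosity_points[OF E] porous_porosity_points]
      borel_porosity_points[OF E] M by (simp add: null_sets_def)
  then have "AE x in M. x \<notin> {x\<in>E. porous_at E x}" by (rule AE_not_in)
  moreover have "f differentiable (at x)" if "x \<in> E" "\<not> porous_at E x" for x
    using has_derivative_of_eq_on_nonporous[OF L g'[of x]] that
    unfolding E_def differentiable_def by blast
  ultimately have "AE x in M. x \<notin> E"
    using assms(5) by (auto elim: eventually_elim2)
  then show ?thesis
    using E M AE_iff_null_sets[of E M] by (simp add: E_def null_sets_def)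
qed

end
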